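(* For every nonnegative integer $m$, the number of partitions of $2m$ whose principal hooks are all even equals the number of overpartitions of $m$.
   Context: The principal hooks of a partition are the hooks of the cells on the main diagonal of its Young diagram; a principal hook is even if its hook length is even. An overpartition is a partition in which the first occurrence of each distinct part may be overlined. *)

theory Defs
  imports Main
begin

definition partitions :: "nat \<Rightarrow> nat list set" where
  "partitions n = {xs. sorted_wrt (\<ge>) xs \<and> (\<forall>x\<in>set xs. 0 < x) \<and> sum_list xs = n}"

(* Cells are pairs (row, column), both counted from 0. *)
definition young_diagram :: "nat list \<Rightarrow> (nat \<times> nat) set" where
  "young_diagram xs = {(i, j). i < length xs \<and> j < xs ! i}"

definition hook :: "nat list \<Rightarrow> nat \<times> nat \<Rightarrow> (nat \<times> nat) set" where
  "hook xs c = {(k, l) \<in> young_diagram xs.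
     (k = fst c \<and> snd c \<le> l) \<or> (l = snd c \<and> fst c \<le> k)}"

definition hook_length :: "nat list \<Rightarrow> nat \<times> nat \<Rightarrow> nat" where
  "hook_length xs c = card (hook xs c)"

definition principal_hooks_even :: "nat list \<Rightarrow> bool" where
  "principal_hooks_even xs \<longleftrightarrow>
     (\<forall>i. (i, i) \<in> young_diagram xs \<longrightarrow> even (hook_length xs (i, i)))"

(* A list entry (x, b) is a part x, overlined iff b; a repeated occurrence of a part
   is never overlined. *)
definition overpartitions :: "nat \<Rightarrow> (nat \<times> bool) list set" where
  "overpartitions n = {ps. map fst ps \<in> partitions n \<and>
     (\<forall>i j. i < j \<and> j < length ps \<and> fst (ps ! i) = fst (ps ! j) \<longrightarrow> \<not> snd (ps ! j))}"

(* Finiteness, so that card counts both families. *)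
lemma partitions_bounds:
  assumes "xs \<in> partitions n"
  shows "set xs \<subseteq> {..n}" "length xs \<le> n"
proof -
  have s: "sum_list xs = n" and p: "\<forall>x\<in>set xs. 0 < x"
    using assms by (auto simp: partitions_def)
  show "set xs \<subseteq> {..n}" using s member_le_sum_list by auto
  have "length xs \<le> sum_list xs" using p by (induction xs) auto
  then show "length xs \<le> n" using s by simp
qed

lemma finite_partitions: "finite (partitions n)"
  by (rule finite_subset[OF _ finite_lists_length_le[of "{..n}" n]])
    (use partitions_bounds in auto)

lemma finite_overpartitions: "finite (overpartitions n)"
proof (rule finite_subset)
  show "overpartitions n \<subseteq> {ps. set ps \<subseteq> {..n} \<times> UNIV \<and> length ps \<le> n}"
  proof
    fix ps assume "ps \<in> overpartitions n"
    then have "map fst ps \<in> partitions n" by (simp add: overpartitions_def)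
    from partitions_bounds[OF this]
    show "ps \<in> {ps. set ps \<subseteq> {..n} \<times> UNIV \<and> length ps \<le> n}" by auto
  qed
  show "finite {ps. set ps \<subseteq> {..n} \<times> (UNIV :: bool set) \<and> length ps \<le> n}"
    by (rule finite_lists_length_le) simp
qed

end

(* By Frobenius symbols, a partition with r principal hooks is given by columns (a_i, b_i), and
   its hooks are even iff every a_i + b_i is odd. Peeling the columns from the innermost one shows
   that the symbols with r columns, weighted by half the size, have generating function X_r with
     X_0 = 1,  (1 - q^(r+1))^2 X_(r+1) = q^(r+1) (1 + q^r) X_r:
   subtracting 2 from a row of the symbol accounts for each factor 1 / (1 - q^(r+1)), and the
   factor 1 + q^r records whether the parity pattern flips between the two innermost columns.
   The sum of X_r is the case N = 0 of
     S_N = sum_r q^(r(r+1)/2 + N r) (-1; q)_r / ((q; q)_r (q^(N+1); q)_r),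
   and a telescoping argument gives (1 - q^(N+1)) S_N = (1 + q^(N+1)) S_(N+1). Overpartitions
   with all parts above N satisfy the same recurrence, and both sides are 1 modulo q^(N+1). *)

theory Submission
  imports Defs "HOL-Computational_Algebra.Formal_Power_Series"
begin

section \<open>Generating functions of weighted sets\<close>

definition finite_fibres :: "('a \<Rightarrow> nat) \<Rightarrow> 'a set \<Rightarrow> bool" where
  "finite_fibres w A \<longleftrightarrow> (\<forall>n. finite {x \<in> A. w x = n})"

text \<open>The coefficients are rational rather than integral so that
  \<open>1 - fps_X ^ Suc k\<close> has an \<open>inverse\<close>. An infinite fibre would be counted
  as 0, which is why \<open>finite_fibres\<close> accompanies every use of additivity.\<close>

definition gen_fun :: "('a \<Rightarrow> nat) \<Rightarrow> 'a set \<Rightarrow> rat fps" where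
  "gen_fun w A = Abs_fps (\<lambda>n. of_nat (card {x \<in> A. w x = n}))"

lemma finite_fibres_subset: "finite_fibres w B \<Longrightarrow> A \<subseteq> B \<Longrightarrow> finite_fibres w A"
  unfolding finite_fibres_def
proof (rule allI)
  fix n assume "\<forall>n. finite {x \<in> B. w x = n}" "A \<subseteq> B"
  then show "finite {x \<in> A. w x = n}"
    by (intro finite_subset[of "{x \<in> A. w x = n}" "{x \<in> B. w x = n}"]) auto
qed

lemma gen_fun_Un:
  assumes "A \<inter> B = {}" "finite_fibres w A" "finite_fibres w B"
  shows "gen_fun w (A \<union> B) = gen_fun w A + gen_fun w B"
proof (rule fps_ext)
  fix n
  have "{x \<in> A \<union> B. w x = n} = {x \<in> A. w x = n} \<union> {x \<in> B. w x = n}" by auto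
  moreover have "{x \<in> A. w x = n} \<inter> {x \<in> B. w x = n} = {}" using assms(1) by auto
  ultimately have "card {x \<in> A \<union> B. w x = n} = card {x \<in> A. w x = n} + card {x \<in> B. w x = n}"
    using assms(2,3) by (simp add: card_Un_disjoint finite_fibres_def)
  then show "fps_nth (gen_fun w (A \<union> B)) n = fps_nth (gen_fun w A + gen_fun w B) n"
    by (simp add: gen_fun_def)
qed

lemma gen_fun_image:
  assumes "inj_on f A" "\<And>x. x \<in> A \<Longrightarrow> v (f x) = w x + k"
  shows "gen_fun v (f ` A) = fps_X ^ k * gen_fun w A"
proof (rule fps_ext)
  fix n
  have eq: "{y \<in> f ` A. v y = n} = f ` {x \<in> A. w x + k = n}"
    using assms(2) by auto
  have "card {y \<in> f ` A. v y = n} = card {x \<in> A. w x + k = n}"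
    unfolding eq by (rule card_image) (rule inj_on_subset[OF assms(1)], auto)
  also have "{x \<in> A. w x + k = n} = (if n < k then {} else {x \<in> A. w x = n - k})"
    by auto
  finally show "fps_nth (gen_fun v (f ` A)) n = fps_nth (fps_X ^ k * gen_fun w A) n"
    by (simp add: gen_fun_def fps_X_power_mult_nth)
qed

text \<open>Divisibility of a difference by \<open>fps_X ^ k\<close> stands for agreement of all
  coefficients below k. It replaces limits throughout: only finite partial sums over r ever
  occur.\<close>

lemma X_power_dvdI:
  assumes "\<And>n. n < k \<Longrightarrow> fps_nth f n = 0"
  shows "fps_X ^ k dvd (f :: 'a :: comm_ring_1 fps)"
proof (rule dvdI)
  show "f = fps_X ^ k * fps_shift k f"
    by (rule fps_ext) (simp add: assms fps_X_power_mult_nth)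
qed

section \<open>Overpartitions\<close>

text \<open>Order and overlining are merged into one pairwise relation, so that appending a smallest
  part only requires comparing it with the earlier entries.\<close>

definition overpartitions_above :: "nat \<Rightarrow> (nat \<times> bool) list set" where
  "overpartitions_above N = {ps. (\<forall>p\<in>set ps. N < fst p) \<and>
     sorted_wrt (\<lambda>p q. fst q \<le> fst p \<and> (fst p = fst q \<longrightarrow> \<not> snd q)) ps}"

abbreviation over_weight :: "(nat \<times> bool) list \<Rightarrow> nat" where
  "over_weight ps \<equiv> sum_list (map fst ps)"

lemma overpartitions_eq: "overpartitions n = {ps \<in> overpartitions_above 0. over_weight ps = n}"
  unfolding overpartitions_def overpartitions_above_def partitions_def
  by (auto simp: sorted_wrt_iff_nth_less)

lemma finite_fibres_overpartitions: "finite_fibres over_weight (overpartitions_above N)"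
proof (rule finite_fibres_subset)
  show "finite_fibres over_weight (overpartitions_above 0)"
    using finite_overpartitions by (simp add: finite_fibres_def overpartitions_eq)
  show "overpartitions_above N \<subseteq> overpartitions_above 0"
    by (auto simp: overpartitions_above_def)
qed

text \<open>The cases are read off the last entry, a smallest part. A plain \<open>Suc N\<close> may
  be removed freely. An overlined \<open>Suc N\<close> in last position is the first occurrence of
  that part, hence the only one, so everything before it exceeds \<open>Suc N\<close>. Otherwise
  \<open>Suc N\<close> does not occur.\<close>

lemma overpartitions_above_split:
  "overpartitions_above N =
     (\<lambda>ps. ps @ [(Suc N, False)]) ` overpartitions_above N \<union>
     ((\<lambda>ps. ps @ [(Suc N, True)]) ` overpartitions_above (Suc N) \<union> overpartitions_above (Suc N))"
  (is "_ = ?F ` _ \<union> (?T ` _ \<union> _)")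
proof (rule set_eqI, rule iffI)
  fix ps assume ps: "ps \<in> overpartitions_above N"
  show "ps \<in> ?F ` overpartitions_above N \<union> (?T ` overpartitions_above (Suc N) \<union> overpartitions_above (Suc N))"
  proof (cases ps rule: rev_cases)
    case Nil
    then show ?thesis by (simp add: overpartitions_above_def)
  next
    case (snoc qs p)
    obtain x b where p: "p = (x, b)" by force
    have qs: "qs \<in> overpartitions_above N" and x: "N < x"
      and le: "\<forall>q\<in>set qs. x \<le> fst q \<and> (fst q = x \<longrightarrow> \<not> b)"
      using ps snoc p by (auto simp: overpartitions_above_def sorted_wrt_append)
    show ?thesis
    proof (cases "x = Suc N")
      case False
      then have "ps \<in> overpartitions_above (Suc N)"
        using ps snoc p x le by (fastforce simp: overpartitions_above_def)
      then show ?thesis by blast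
    next
      case True
      show ?thesis
      proof (cases b)
        case True
        then have "qs \<in> overpartitions_above (Suc N)"
          using qs le \<open>x = Suc N\<close> by (force simp: overpartitions_above_def)
        then show ?thesis using True snoc p \<open>x = Suc N\<close> by blast
      next
        case False
        then show ?thesis using qs snoc p \<open>x = Suc N\<close> by blast
      qed
    qed
  qed
qed ((auto simp: overpartitions_above_def sorted_wrt_append Suc_le_eq); fastforce)

lemma gen_fun_overpartitions_rec:
  "(1 - fps_X ^ Suc N) * gen_fun over_weight (overpartitions_above N) =
   (1 + fps_X ^ Suc N) * gen_fun over_weight (overpartitions_above (Suc N))"
proof -
  let ?G = "\<lambda>N. gen_fun over_weight (overpartitions_above N)"
  let ?A = "(\<lambda>ps. ps @ [(Suc N, False)]) ` overpartitions_above N"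
  let ?B = "(\<lambda>ps. ps @ [(Suc N, True)]) ` overpartitions_above (Suc N)"
  have sub: "?A \<subseteq> overpartitions_above N" "?B \<union> overpartitions_above (Suc N) \<subseteq> overpartitions_above N"
    using equalityD2[OF overpartitions_above_split[of N]] by (simp_all only: Un_subset_iff)
  have fin: "finite_fibres over_weight A" if "A \<subseteq> overpartitions_above N" for A
    using finite_fibres_overpartitions that by (rule finite_fibres_subset)
  have not: "qs @ [(Suc N, b)] \<notin> overpartitions_above (Suc N)" for qs b
    by (simp add: overpartitions_above_def)
  have "?G N = gen_fun over_weight (?A \<union> (?B \<union> overpartitions_above (Suc N)))"
    by (rule arg_cong[OF overpartitions_above_split])
  also have "\<dots> = gen_fun over_weight ?A + (gen_fun over_weight ?B + ?G (Suc N))"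
  proof -
    have "gen_fun over_weight (?B \<union> overpartitions_above (Suc N)) =
        gen_fun over_weight ?B + ?G (Suc N)"
      using not sub by (intro gen_fun_Un fin) auto
    moreover have "?A \<inter> (?B \<union> overpartitions_above (Suc N)) = {}" using not by auto
    ultimately show ?thesis
      using gen_fun_Un[OF _ fin[OF sub(1)] fin[OF sub(2)]] by simp
  qed
  also have "gen_fun over_weight ?A = fps_X ^ Suc N * ?G N"
    by (rule gen_fun_image) (auto simp: inj_on_def)
  also have "gen_fun over_weight ?B = fps_X ^ Suc N * ?G (Suc N)"
    by (rule gen_fun_image) (auto simp: inj_on_def)
  finally show ?thesis
    unfolding left_diff_distrib distrib_right mult_1 by (metis add_diff_cancel_left' add.commute)
qed

text \<open>A nonempty list with all parts above N has weight at least N + 1, so only the empty one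
  contributes in lower degrees.\<close>

lemma gen_fun_overpartitions_cong: "fps_X ^ Suc N dvd gen_fun over_weight (overpartitions_above N) - 1"
proof -
  have "fps_nth (gen_fun over_weight (overpartitions_above N) - 1) n = 0" if "n < Suc N" for n
  proof -
    define S where "S = {ps \<in> overpartitions_above N. over_weight ps = n}"
    have "S \<subseteq> {[]}"
    proof
      fix ps assume "ps \<in> S"
      then show "ps \<in> {[]}"
        using \<open>n < Suc N\<close> by (cases ps) (auto simp: S_def overpartitions_above_def)
    qed
    moreover have "[] \<in> S \<longleftrightarrow> n = 0" by (auto simp: S_def overpartitions_above_def)
    ultimately have "card S = (if n = 0 then 1 else 0)" by (auto simp: subset_singleton_iff)
    then show ?thesis by (simp add: gen_fun_def S_def)
  qed
  then show ?thesis by (rule X_power_dvdI)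
qed

section \<open>A telescoping form of the limiting q-Gauss sum\<close>

text \<open>The summand of S_N, given by the ratio of consecutive terms. The product of the factors
  \<open>1 + fps_X ^ r\<close> is (-1; q)_r, whose first factor is 2.\<close>

fun gauss_term :: "nat \<Rightarrow> nat \<Rightarrow> rat fps" where
  "gauss_term N 0 = 1"
| "gauss_term N (Suc r) = gauss_term N r * fps_X ^ (N + Suc r) * (1 + fps_X ^ r) *
     inverse (1 - fps_X ^ Suc r) * inverse (1 - fps_X ^ (N + Suc r))"

lemma inverse_one_minus_X_power:
  "(1 - fps_X ^ Suc k) * inverse (1 - fps_X ^ Suc k :: rat fps) = 1"
  by (rule inverse_mult_eq_1') simp

lemma one_minus_X_power_nonzero: "(1 - fps_X ^ Suc k :: rat fps) \<noteq> 0"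
  using inverse_one_minus_X_power[of k] by (metis mult_zero_left zero_neq_one)

lemma gauss_term_Suc:
  "(1 - fps_X ^ Suc r) * (1 - fps_X ^ Suc (N + r)) * gauss_term N (Suc r) =
     fps_X ^ Suc (N + r) * (1 + fps_X ^ r) * gauss_term N r"
proof -
  have cancel: "a * b * (s * v * p * a' * b') = v * p * s"
    if "a * a' = 1" "b * b' = 1" for a b a' b' s v p :: "rat fps"
  proof -
    have "a * b * (s * v * p * a' * b') = (a * a') * (b * b') * (v * p * s)" by (simp only: mult_ac)
    then show ?thesis unfolding that by (simp only: mult_1)
  qed
  show ?thesis unfolding gauss_term.simps add_Suc_right
    by (rule cancel) (rule inverse_one_minus_X_power)+
qed

text \<open>Passing from N to N + 1 multiplies the numerator by q^r, while (q^(N+1); q)_r loses its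
  first factor 1 - q^(N+1) and gains 1 - q^(N+r+1) at the end.\<close>

lemma gauss_term_shift:
  "(1 - fps_X ^ Suc (N + r)) * gauss_term (Suc N) r = fps_X ^ r * (1 - fps_X ^ Suc N) * gauss_term N r"
proof (induction r)
  case (Suc r)
  define A B C K P V :: "rat fps" where "A = 1 - fps_X ^ Suc r" and "B = 1 - fps_X ^ Suc (N + r)"
    and "C = 1 - fps_X ^ Suc (Suc N + r)" and "K = 1 - fps_X ^ Suc N" and "P = fps_X ^ r"
    and "V = fps_X ^ Suc (N + r)"
  define s s' t t' where "s = gauss_term N r" and "s' = gauss_term N (Suc r)"
    and "t = gauss_term (Suc N) r" and "t' = gauss_term (Suc N) (Suc r)"
  note defs = A_def B_def C_def K_def P_def V_def s_def s'_def t_def t'_def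
  have IH: "B * t = P * K * s"
    unfolding defs by (rule Suc)
  have 1: "A * C * t' = (fps_X * V) * (1 + P) * t"
    using gauss_term_Suc[of r "Suc N"] unfolding defs power_Suc[of fps_X "Suc (N + r)", symmetric] by simp
  have 2: "A * B * s' = V * (1 + P) * s"
    unfolding defs by (rule gauss_term_Suc)
  have "A * B * (C * t') = B * (A * C * t')" by (simp only: mult_ac)
  also have "\<dots> = (fps_X * V) * (1 + P) * (B * t)" unfolding 1 by (simp only: mult_ac)
  also have "\<dots> = (fps_X * P) * K * (V * (1 + P) * s)" unfolding IH by (simp only: mult_ac)
  also have "\<dots> = A * B * ((fps_X * P) * K * s')" unfolding 2[symmetric] by (simp only: mult_ac)
  finally have "A * B * (C * t') = A * B * ((fps_X * P) * K * s')" .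
  moreover have "A * B \<noteq> 0" unfolding A_def B_def using one_minus_X_power_nonzero by (metis no_zero_divisors)
  ultimately have "C * t' = (fps_X * P) * K * s'" by (metis mult_left_cancel)
  then show ?case unfolding defs by (simp only: power_Suc add_Suc_right add_Suc)
qed simp

text \<open>The telescoping certificate is (1 - q^(N+1)) (1 - q^r) times the summand. After
  multiplication by 1 - q^(N+r+1), the two preceding lemmas express everything through
  \<open>gauss_term N r\<close>, and a polynomial identity in q^r and q^(N+1) is left.\<close>

lemma gauss_term_telescope:
  "(1 - fps_X ^ Suc N) * gauss_term N r - (1 + fps_X ^ Suc N) * gauss_term (Suc N) r =
   (1 - fps_X ^ Suc N) * (1 - fps_X ^ r) * gauss_term N r -
   (1 - fps_X ^ Suc N) * (1 - fps_X ^ Suc r) * gauss_term N (Suc r)"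
proof -
  define Q P R :: "rat fps" where "Q = fps_X ^ Suc N" and "P = fps_X ^ r" and "R = fps_X ^ Suc (N + r)"
  define R1 where "R1 = (fps_X ^ Suc r :: rat fps)"
  define s s' t where "s = gauss_term N r" and "s' = gauss_term N (Suc r)" and "t = gauss_term (Suc N) r"
  have R: "R = P * Q" by (simp add: R_def P_def Q_def power_add)
  have 1: "(1 - R1) * (1 - R) * s' = R * (1 + P) * s"
    unfolding R_def R1_def s'_def s_def P_def by (rule gauss_term_Suc)
  have 2: "(1 - R) * t = P * (1 - Q) * s"
    unfolding R_def P_def Q_def s_def t_def by (rule gauss_term_shift)
  have "(1 - R) * ((1 - Q) * s - (1 + Q) * t - ((1 - Q) * (1 - P) * s - (1 - Q) * (1 - R1) * s')) =
    (1 - R) * (1 - Q) * P * s - (1 + Q) * ((1 - R) * t) + (1 - Q) * ((1 - R1) * (1 - R) * s')"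
    by (simp add: algebra_simps)
  also have "\<dots> = 0" unfolding 1 2 by (simp add: R algebra_simps)
  finally have "(1 - R) * ((1 - Q) * s - (1 + Q) * t - ((1 - Q) * (1 - P) * s - (1 - Q) * (1 - R1) * s')) = 0" .
  moreover have "1 - R \<noteq> 0" unfolding R_def by (rule one_minus_X_power_nonzero)
  ultimately show ?thesis
    by (simp add: Q_def P_def R1_def s_def s'_def t_def del: power_Suc gauss_term.simps)
qed

lemma X_power_dvd_gauss_term: "fps_X ^ r dvd gauss_term N r"
proof (cases r)
  case (Suc k)
  have "(fps_X :: rat fps) ^ r dvd fps_X ^ (N + Suc k)" by (rule le_imp_power_dvd) (simp add: Suc)
  then show ?thesis unfolding Suc gauss_term.simps by (rule dvd_mult2[OF dvd_mult2[OF dvd_mult2[OF dvd_mult]]])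
qed simp

text \<open>The lower boundary term vanishes because 1 - q^0 = 0, and the upper one is a multiple of
  \<open>gauss_term N (Suc R)\<close>, hence of q^(R+1).\<close>

lemma gauss_sum_rec:
  "fps_X ^ Suc R dvd (1 - fps_X ^ Suc N) * (\<Sum>r\<le>R. gauss_term N r) -
     (1 + fps_X ^ Suc N) * (\<Sum>r\<le>R. gauss_term (Suc N) r)"
proof -
  define U where "U r = (1 - fps_X ^ Suc N) * (1 - fps_X ^ r) * gauss_term N r" for r
  have "(1 - fps_X ^ Suc N) * (\<Sum>r\<le>R. gauss_term N r) -
     (1 + fps_X ^ Suc N) * (\<Sum>r\<le>R. gauss_term (Suc N) r) = (\<Sum>r\<le>R. U r - U (Suc r))"
    unfolding U_def gauss_term_telescope[symmetric] by (simp only: sum_distrib_left sum_subtractf)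
  also have "\<dots> = U 0 - U (Suc R)" by (rule sum_telescope)
  also have "U 0 = 0" by (simp add: U_def)
  finally show ?thesis
    using X_power_dvd_gauss_term[of "Suc R" N] by (simp add: U_def del: power_Suc gauss_term.simps)
qed

lemma gauss_sum_cong: "fps_X ^ Suc N dvd (\<Sum>r\<le>R. gauss_term N r) - 1"
proof (induction R)
  case (Suc R)
  have "(fps_X :: rat fps) ^ Suc N dvd fps_X ^ (N + Suc R)" by (rule le_imp_power_dvd) simp
  then have "fps_X ^ Suc N dvd gauss_term N (Suc R)"
    unfolding gauss_term.simps by (rule dvd_mult2[OF dvd_mult2[OF dvd_mult2[OF dvd_mult]]])
  with Suc show ?case
    by (metis (no_types, lifting) add_diff_eq add.commute dvd_add sum.atMost_Suc)
qed simp

lemma gauss_sum_overpartitions: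
  "fps_X ^ Suc R dvd (\<Sum>r\<le>R. gauss_term 0 r) - gen_fun over_weight (overpartitions_above 0)"
proof -
  define D where "D N = (\<Sum>r\<le>R. gauss_term N r) - gen_fun over_weight (overpartitions_above N)" for N
  have "fps_X ^ Suc R dvd D N" if "N \<le> R" for N
    using that
  \<comment> \<open>Descending induction from N = R, where both series are 1 modulo q^(R+1).\<close>
  proof (induction N rule: inc_induct)
    case base
    show ?case
      using dvd_diff[OF gauss_sum_cong[of R R] gen_fun_overpartitions_cong[of R]] by (simp add: D_def)
  next
    case (step N)
    have "(1 - fps_X ^ Suc N) * D N - (1 + fps_X ^ Suc N) * D (Suc N) =
      (1 - fps_X ^ Suc N) * (\<Sum>r\<le>R. gauss_term N r) - (1 + fps_X ^ Suc N) * (\<Sum>r\<le>R. gauss_term (Suc N) r)"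
      using gen_fun_overpartitions_rec[of N] unfolding D_def right_diff_distrib by (simp only: diff_diff_eq2) simp
    then have "fps_X ^ Suc R dvd (1 - fps_X ^ Suc N) * D N - (1 + fps_X ^ Suc N) * D (Suc N)"
      using gauss_sum_rec[of R N] by simp
    then have "fps_X ^ Suc R dvd (1 - fps_X ^ Suc N) * D N"
      using step.IH by (metis dvd_mult diff_add_cancel dvd_add)
    \<comment> \<open>The factor 1 - q^(N+1) is a unit, so it can be divided out without losing
      precision.\<close>
    then have "fps_X ^ Suc R dvd inverse (1 - fps_X ^ Suc N) * ((1 - fps_X ^ Suc N) * D N)"
      by (rule dvd_mult)
    then show ?case
      using inverse_one_minus_X_power[of N] by (metis mult.assoc mult.commute mult_1)
  qed
  from this[of 0] show ?thesis by (simp add: D_def)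
qed

section \<open>Frobenius symbols with columns of odd sum\<close>

text \<open>Columns are listed from the innermost principal hook outwards, so that the entries increase.\<close>

definition symbols :: "nat \<Rightarrow> (nat \<times> nat) list set" where
  "symbols r = {ps. length ps = r \<and> sorted_wrt (\<lambda>p q. fst p < fst q \<and> snd p < snd q) ps \<and>
     (\<forall>p\<in>set ps. odd (fst p + snd p))}"

text \<open>A column (a, b) stands for a principal hook of length a + b + 1 (arm, leg and corner);
  on \<open>symbols\<close> the halving is exact because a + b is odd.\<close>

definition half_hooks :: "(nat \<times> nat) list \<Rightarrow> nat" where
  "half_hooks ps = (\<Sum>p\<leftarrow>ps. (fst p + snd p + 1) div 2)"

definition shift :: "nat \<Rightarrow> nat \<Rightarrow> (nat \<times> nat) list \<Rightarrow> (nat \<times> nat) list" where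
  "shift i j = map (\<lambda>p. (fst p + i, snd p + j))"

lemma symbols_0: "symbols 0 = {[]}"
  by (auto simp: symbols_def)

lemma shift_in_symbols_iff: "even (i + j) \<Longrightarrow> shift i j ps \<in> symbols r \<longleftrightarrow> ps \<in> symbols r"
  by (auto simp: shift_def symbols_def sorted_wrt_map)

lemma inj_shift: "inj (shift i j)"
  unfolding shift_def by (rule inj_mapI) (auto simp: inj_def)

lemma half_hooks_shift: "half_hooks (shift (2 * i) (2 * j) ps) = half_hooks ps + (i + j) * length ps"
proof (induction ps)
  case (Cons p ps)
  have "(fst p + 2 * i + (snd p + 2 * j) + 1) div 2 = (fst p + snd p + 1) div 2 + (i + j)" by linarith
  with Cons show ?case by (simp add: half_hooks_def shift_def)
qed (simp add: half_hooks_def shift_def)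

lemma shift_surj:
  assumes "\<forall>p\<in>set ps. i \<le> fst p \<and> j \<le> snd p"
  obtains qs where "ps = shift i j qs"
proof
  show "ps = shift i j (map (\<lambda>p. (fst p - i, snd p - j)) ps)"
    using assms by (simp add: shift_def o_def map_idI)
qed

lemma symbols_hd_le:
  "ps \<in> symbols r \<Longrightarrow> p \<in> set ps \<Longrightarrow> fst (hd ps) \<le> fst p \<and> snd (hd ps) \<le> snd p"
  by (cases ps) (auto simp: symbols_def less_imp_le)

lemma finite_fibres_symbols: "finite_fibres half_hooks (symbols r)"
  unfolding finite_fibres_def
proof
  fix n
  have "{ps \<in> symbols r. half_hooks ps = n} \<subseteq> {ps. set ps \<subseteq> {..2 * n} \<times> {..2 * n} \<and> length ps = r}"
  proof
    fix ps assume ps: "ps \<in> {ps \<in> symbols r. half_hooks ps = n}"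
    have "p \<in> {..2 * n} \<times> {..2 * n}" if "p \<in> set ps" for p
    proof -
      have "(fst p + snd p + 1) div 2 \<in> set (map (\<lambda>p. (fst p + snd p + 1) div 2) ps)"
        using that by auto
      then have "(fst p + snd p + 1) div 2 \<le> half_hooks ps"
        unfolding half_hooks_def by (rule member_le_sum_list) simp
      then have "(fst p + snd p + 1) div 2 \<le> n" using ps by simp
      then have "fst p \<le> 2 * n" "snd p \<le> 2 * n" by linarith+
      then show ?thesis by (simp add: mem_Times_iff)
    qed
    with ps show "ps \<in> {ps. set ps \<subseteq> {..2 * n} \<times> {..2 * n} \<and> length ps = r}"
      by (auto simp: symbols_def)
  qed
  then show "finite {ps \<in> symbols r. half_hooks ps = n}"
    by (rule finite_subset) (intro finite_lists_length_eq finite_cartesian_product finite_atMost)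
qed

section \<open>Removing rows and the innermost column from a symbol\<close>

lemma fixed_point_solve: "(a :: 'a :: comm_ring_1) = q * a + b \<Longrightarrow> (1 - q) * a = b"
  unfolding left_diff_distrib mult_1 by (metis add_diff_cancel_left')

text \<open>Exactly one of i, j is 1, so the shift adds 2 to every entry of a single row and raises
  the weight by the number r + 1 of columns. Since the head is the smallest column, it alone decides
  whether the shift can be undone; for the untouched row the bound is \<open>< 0\<close> and never
  applies.\<close>

lemma gen_fun_symbols_peel:
  assumes i: "i + j = 1"
    and A: "A \<subseteq> symbols (Suc r)"
    and inv: "\<And>ps. ps \<in> symbols (Suc r) \<Longrightarrow> shift (2 * i) (2 * j) ps \<in> A \<longleftrightarrow> ps \<in> A"
  shows "(1 - fps_X ^ Suc r) * gen_fun half_hooks A =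
    gen_fun half_hooks {ps \<in> A. fst (hd ps) < 2 * i \<or> snd (hd ps) < 2 * j}"
proof (rule fixed_point_solve)
  let ?B = "{ps \<in> A. fst (hd ps) < 2 * i \<or> snd (hd ps) < 2 * j}"
  let ?S = "shift (2 * i) (2 * j)"
  have S: "?S ps \<in> symbols (Suc r) \<longleftrightarrow> ps \<in> symbols (Suc r)" for ps
    by (rule shift_in_symbols_iff) simp
  have fin: "finite_fibres half_hooks C" if "C \<subseteq> A" for C
    using finite_fibres_symbols subset_trans[OF that A] by (rule finite_fibres_subset)
  have image_sub: "?S ` A \<subseteq> A" using inv A by blast
  have "A \<subseteq> ?S ` A \<union> ?B"
  proof
    fix ps assume ps: "ps \<in> A"
    show "ps \<in> ?S ` A \<union> ?B"
    proof (cases "ps \<in> ?B")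
      case False
      have "\<forall>p\<in>set ps. 2 * i \<le> fst p \<and> 2 * j \<le> snd p"
      proof
        fix p assume "p \<in> set ps"
        then show "2 * i \<le> fst p \<and> 2 * j \<le> snd p"
          using symbols_hd_le[of ps "Suc r" p] ps A False by auto
      qed
      then obtain qs where qs: "ps = ?S qs" by (rule shift_surj)
      then have "qs \<in> A" using ps A S inv by blast
      then show ?thesis using qs by blast
    qed simp
  qed
  then have eq: "A = ?S ` A \<union> ?B" using image_sub by blast
  have "?S ` A \<inter> ?B = {}"
  proof -
    have "?S ps \<notin> ?B" if "ps \<in> A" for ps
    proof -
      have "ps \<noteq> []" using that A by (auto simp: symbols_def)
      then show ?thesis by (cases ps) (auto simp: shift_def)
    qed
    then show ?thesis by blast
  qed
  then have "gen_fun half_hooks (?S ` A \<union> ?B) = gen_fun half_hooks (?S ` A) + gen_fun half_hooks ?B"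
    using image_sub by (intro gen_fun_Un fin) auto
  also have "gen_fun half_hooks (?S ` A) = fps_X ^ Suc r * gen_fun half_hooks A"
  proof (rule gen_fun_image)
    show "inj_on ?S A" using inj_shift by (rule inj_on_subset) simp
    show "half_hooks (?S ps) = half_hooks ps + Suc r" if "ps \<in> A" for ps
      using that A i by (auto simp: half_hooks_shift symbols_def)
  qed
  finally show "gen_fun half_hooks A = fps_X ^ Suc r * gen_fun half_hooks A + gen_fun half_hooks ?B"
    using eq by argo
qed

definition corner_symbols :: "nat \<Rightarrow> (nat \<times> nat) list set" where
  "corner_symbols r = {ps \<in> symbols r. fst (hd ps) < 2 \<and> snd (hd ps) < 2}"

lemma gen_fun_symbols_corner:
  "(1 - fps_X ^ Suc r) * (1 - fps_X ^ Suc r) * gen_fun half_hooks (symbols (Suc r)) =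
    gen_fun half_hooks (corner_symbols (Suc r))"
proof -
  let ?Y = "{ps \<in> symbols (Suc r). fst (hd ps) < 2}"
  have 1: "(1 - fps_X ^ Suc r) * gen_fun half_hooks (symbols (Suc r)) = gen_fun half_hooks ?Y"
    using gen_fun_symbols_peel[of 1 0 "symbols (Suc r)" r] by (simp add: shift_in_symbols_iff)
  \<comment> \<open>The second row can be treated inside \<open>?Y\<close>, since shifting it leaves
    the condition on the first row intact.\<close>
  have "fst (hd (shift 0 2 ps)) = fst (hd ps)" if "ps \<in> symbols (Suc r)" for ps
    using that by (cases ps) (auto simp: shift_def symbols_def)
  then have "(1 - fps_X ^ Suc r) * gen_fun half_hooks ?Y = gen_fun half_hooks {ps \<in> ?Y. snd (hd ps) < 2}"
    using gen_fun_symbols_peel[of 0 1 ?Y r] by (simp add: shift_in_symbols_iff)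
  also have "{ps \<in> ?Y. snd (hd ps) < 2} = corner_symbols (Suc r)"
    by (auto simp: corner_symbols_def)
  finally show ?thesis unfolding mult.assoc 1 .
qed

text \<open>The empty symbol is assigned to the even class by convention, so that for r = 0 the
  decomposition below yields [(0, 1)] and [(1, 0)] exactly once each.\<close>

definition even_top :: "nat \<Rightarrow> (nat \<times> nat) list set" where
  "even_top r = {ps \<in> symbols r. ps = [] \<or> even (fst (hd ps))}"

text \<open>The innermost column is (0, 1) or (1, 0). Below (0, 1) the remaining columns have top at
  least 1 and bottom at least 2. If the next top is even it is at least 2, and 2 can be subtracted
  from both rows; if it is odd, 2 is subtracted from the bottom row only. The case (1, 0) is
  symmetric, the next bottom being even iff the next top is odd.\<close>

lemma corner_symbols_Suc:
  "corner_symbols (Suc r) =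
     ((\<lambda>ps. (0, 1) # shift 2 2 ps) ` even_top r \<union>
      (\<lambda>ps. (0, 1) # shift 0 2 ps) ` (symbols r - even_top r)) \<union>
     ((\<lambda>ps. (1, 0) # shift 2 2 ps) ` (symbols r - even_top r) \<union>
      (\<lambda>ps. (1, 0) # shift 2 0 ps) ` even_top r)"
  (is "_ = ?R")
proof
  show "corner_symbols (Suc r) \<subseteq> ?R"
  proof
    fix ps assume ps: "ps \<in> corner_symbols (Suc r)"
    then obtain p qs where c: "ps = p # qs" by (cases ps) (auto simp: corner_symbols_def symbols_def)
    have qs: "qs \<in> symbols r" and p: "fst p < 2" "snd p < 2" "odd (fst p + snd p)"
      and lt: "\<And>q. q \<in> set qs \<Longrightarrow> fst p < fst q \<and> snd p < snd q"
      using ps c by (auto simp: corner_symbols_def symbols_def)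
    have lower: "(\<exists>us \<in> symbols r. qs = shift i j us)"
      if "qs \<noteq> [] \<Longrightarrow> i \<le> fst (hd qs) \<and> j \<le> snd (hd qs)" "even (i + j)" for i j
    proof -
      have "\<forall>q\<in>set qs. i \<le> fst q \<and> j \<le> snd q"
        using that(1) symbols_hd_le[OF qs] by (metis empty_iff empty_set order_trans)
      then obtain us where "qs = shift i j us" by (rule shift_surj)
      then show ?thesis using qs that(2) by (auto simp: shift_in_symbols_iff)
    qed
    have parity: "odd (fst (hd qs) + snd (hd qs))" if "qs \<noteq> []"
      using that qs by (auto simp: symbols_def)
    have hd_lt: "fst p < fst (hd qs) \<and> snd p < snd (hd qs)" if "qs \<noteq> []"
      using that lt by simp
    have top: "us \<in> even_top r \<longleftrightarrow> qs = [] \<or> even (fst (hd qs))"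
      if "us \<in> symbols r" "qs = shift i j us" "even i" for us i j
      using that by (cases us) (auto simp: even_top_def shift_def)
    have "p = (0, 1) \<or> p = (1, 0)"
    proof -
      have "fst p = 0 \<or> fst p = 1" "snd p = 0 \<or> snd p = 1" using p by linarith+
      then show ?thesis using p(3) by (cases p) auto
    qed
    then show "ps \<in> ?R"
    proof
      assume p: "p = (0, 1)"
      show ?thesis
      proof (cases "qs = [] \<or> even (fst (hd qs))")
        case True
        have "2 \<le> fst (hd qs) \<and> 2 \<le> snd (hd qs)" if "qs \<noteq> []"
          using True hd_lt that p by (auto elim!: evenE)
        then obtain us where "us \<in> symbols r" "qs = shift 2 2 us" using lower[of 2 2] by auto
        then show ?thesis using top[of us 2 2] True c p by auto
      next
        case False
        then have "2 \<le> snd (hd qs)" using hd_lt p by auto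
        then obtain us where "us \<in> symbols r" "qs = shift 0 2 us" using lower[of 0 2] by auto
        then show ?thesis using top[of us 0 2] False c p by auto
      qed
    next
      assume p: "p = (1, 0)"
      show ?thesis
      proof (cases "qs = [] \<or> even (fst (hd qs))")
        case True
        have "2 \<le> fst (hd qs)" if "qs \<noteq> []"
          using hd_lt that p by auto
        then obtain us where "us \<in> symbols r" "qs = shift 2 0 us" using lower[of 2 0] by auto
        then show ?thesis using top[of us 2 0] True c p by auto
      next
        case False
        then have "even (snd (hd qs))" using parity by auto
        then have "2 \<le> fst (hd qs) \<and> 2 \<le> snd (hd qs)"
          using False hd_lt p by (auto elim!: evenE)
        then obtain us where "us \<in> symbols r" "qs = shift 2 2 us" using lower[of 2 2] by auto
        then show ?thesis using top[of us 2 2] False c p by auto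
      qed
    qed
  qed
  have mem: "(a, b) # shift i j ps \<in> corner_symbols (Suc r)"
    if "ps \<in> symbols r" "even (i + j)" "odd (a + b)" "a < 2" "b < 2"
      "\<And>q. q \<in> set ps \<Longrightarrow> a < fst q + i \<and> b < snd q + j" for a b i j ps
  proof -
    have "shift i j ps \<in> symbols r" using that(1,2) by (simp add: shift_in_symbols_iff)
    then show ?thesis using that(3-6) by (auto simp: corner_symbols_def symbols_def shift_def)
  qed
  have even_top_sub: "even_top r \<subseteq> symbols r" by (auto simp: even_top_def)
  \<comment> \<open>An odd smallest entry is positive, so the row that is not shifted already lies
    above the 0 or 1 placed before it: here the top row over 0, next the bottom row over 0.\<close>
  have odd_top: "0 < fst q" if "ps \<in> symbols r - even_top r" "q \<in> set ps" for ps q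
  proof -
    have "odd (fst (hd ps))" using that by (auto simp: even_top_def)
    then show ?thesis using symbols_hd_le[of ps r q] that by (auto intro: Nat.gr0I)
  qed
  have even_top_snd: "0 < snd q" if "ps \<in> even_top r" "q \<in> set ps" for ps q
  proof -
    have "ps \<noteq> []" "ps \<in> symbols r" using that by (auto simp: even_top_def)
    then have "odd (fst (hd ps) + snd (hd ps))" by (auto simp: symbols_def)
    then have "odd (snd (hd ps))" using that by (auto simp: even_top_def)
    then show ?thesis using symbols_hd_le[of ps r q] that \<open>ps \<in> symbols r\<close> by (auto intro: Nat.gr0I)
  qed
  show "?R \<subseteq> corner_symbols (Suc r)"
    using even_top_sub odd_top even_top_snd by (auto intro!: mem)
qed

text \<open>The new column weighs 1, and each row shifted by 2 costs another r.\<close>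

lemma gen_fun_corner_symbols:
  "gen_fun half_hooks (corner_symbols (Suc r)) = fps_X ^ Suc r * (1 + fps_X ^ r) * gen_fun half_hooks (symbols r)"
proof -
  let ?E = "even_top r" and ?O = "symbols r - even_top r"
  let ?f = "\<lambda>p i j ps. p # shift i j ps :: (nat \<times> nat) list"
  let ?G = "gen_fun half_hooks"
  have sub: "?E \<subseteq> symbols r" by (auto simp: even_top_def)
  have fin: "finite_fibres half_hooks C" if "C \<subseteq> symbols k" for C k
    using finite_fibres_symbols that by (rule finite_fibres_subset)
  have fin': "finite_fibres half_hooks C" if "C \<subseteq> corner_symbols (Suc r)" for C
    using that by (intro fin[of C "Suc r"]) (auto simp: corner_symbols_def)
  have image: "?G (?f p (2 * i) (2 * j) ` C) = fps_X ^ ((i + j) * r + 1) * ?G C"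
    if "C \<subseteq> symbols r" "fst p + snd p = 1" for p i j C
  proof (rule gen_fun_image)
    show "inj_on (?f p (2 * i) (2 * j)) C"
      using inj_shift[of "2 * i" "2 * j"] by (auto simp: inj_on_def)
    show "half_hooks (?f p (2 * i) (2 * j) ps) = half_hooks ps + ((i + j) * r + 1)" if "ps \<in> C" for ps
    proof -
      have "half_hooks (?f p (2 * i) (2 * j) ps) = 1 + half_hooks (shift (2 * i) (2 * j) ps)"
        using \<open>fst p + snd p = 1\<close> by (simp add: half_hooks_def)
      then show ?thesis using that \<open>C \<subseteq> symbols r\<close> by (auto simp: half_hooks_shift symbols_def)
    qed
  qed
  \<comment> \<open>Even shifts preserve the parity of the head's top entry, which separates the two
    families.\<close>
  have hd_even: "shift 2 2 us \<noteq> shift 0 2 vs" "shift 2 2 vs \<noteq> shift 2 0 us" if "us \<in> ?E" "vs \<in> ?O" for us vs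
    using that by (cases us; cases vs; auto simp: even_top_def shift_def)+
  have split: "corner_symbols (Suc r) = (?f (0, 1) 2 2 ` ?E \<union> ?f (0, 1) 0 2 ` ?O) \<union>
      (?f (1, 0) 2 2 ` ?O \<union> ?f (1, 0) 2 0 ` ?E)"
    by (rule corner_symbols_Suc)
  have sub_corner: "?f (0, 1) 2 2 ` ?E \<subseteq> corner_symbols (Suc r)" "?f (0, 1) 0 2 ` ?O \<subseteq> corner_symbols (Suc r)"
    "?f (1, 0) 2 2 ` ?O \<subseteq> corner_symbols (Suc r)" "?f (1, 0) 2 0 ` ?E \<subseteq> corner_symbols (Suc r)"
    using equalityD2[OF split] by (simp_all only: Un_subset_iff)
  have "?G (corner_symbols (Suc r)) = ?G (?f (0, 1) 2 2 ` ?E \<union> ?f (0, 1) 0 2 ` ?O) +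
      ?G (?f (1, 0) 2 2 ` ?O \<union> ?f (1, 0) 2 0 ` ?E)"
    unfolding split
  proof (rule gen_fun_Un)
    show "(?f (0, 1) 2 2 ` ?E \<union> ?f (0, 1) 0 2 ` ?O) \<inter> (?f (1, 0) 2 2 ` ?O \<union> ?f (1, 0) 2 0 ` ?E) = {}"
      by auto
  qed (use sub_corner in \<open>simp_all only: fin' Un_subset_iff\<close>)
  also have "?G (?f (0, 1) 2 2 ` ?E \<union> ?f (0, 1) 0 2 ` ?O) =
      ?G (?f (0, 1) 2 2 ` ?E) + ?G (?f (0, 1) 0 2 ` ?O)"
  proof (rule gen_fun_Un)
    show "?f (0, 1) 2 2 ` ?E \<inter> ?f (0, 1) 0 2 ` ?O = {}"
      using hd_even(1) by blast
  qed (use sub_corner in \<open>simp_all only: fin'\<close>)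
  also have "?G (?f (1, 0) 2 2 ` ?O \<union> ?f (1, 0) 2 0 ` ?E) =
      ?G (?f (1, 0) 2 2 ` ?O) + ?G (?f (1, 0) 2 0 ` ?E)"
  proof (rule gen_fun_Un)
    show "?f (1, 0) 2 2 ` ?O \<inter> ?f (1, 0) 2 0 ` ?E = {}"
      using hd_even(2) by blast
  qed (use sub_corner in \<open>simp_all only: fin'\<close>)
  also have "?G (?f (0, 1) 2 2 ` ?E) = fps_X ^ (2 * r + 1) * ?G ?E"
    using image[of ?E "(0, 1)" 1 1] sub by (simp add: numeral_2_eq_2)
  also have "?G (?f (0, 1) 0 2 ` ?O) = fps_X ^ (r + 1) * ?G ?O"
    using image[of ?O "(0, 1)" 0 1] by simp
  also have "?G (?f (1, 0) 2 2 ` ?O) = fps_X ^ (2 * r + 1) * ?G ?O"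
    using image[of ?O "(1, 0)" 1 1] by (simp add: numeral_2_eq_2)
  also have "?G (?f (1, 0) 2 0 ` ?E) = fps_X ^ (r + 1) * ?G ?E"
    using image[of ?E "(1, 0)" 1 0] sub by simp
  \<comment> \<open>Both parity classes occur once with each of the two exponents, so the split by
    parity disappears from the result.\<close>
  also have "fps_X ^ (2 * r + 1) * ?G ?E + fps_X ^ (r + 1) * ?G ?O +
      (fps_X ^ (2 * r + 1) * ?G ?O + fps_X ^ (r + 1) * ?G ?E) =
      fps_X ^ Suc r * (1 + fps_X ^ r) * (?G ?E + ?G ?O)"
  proof -
    have "x * p * e + x * d + (x * p * d + x * e) = x * (1 + p) * (e + d)" for x p d e :: "rat fps"
      by (simp add: algebra_simps)
    moreover have "(fps_X :: rat fps) ^ (2 * r + 1) = fps_X ^ Suc r * fps_X ^ r"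
      unfolding power_add[symmetric] by (rule arg_cong) simp
    ultimately show ?thesis by (simp only: Suc_eq_plus1)
  qed
  also have "?G ?E + ?G ?O = ?G (?E \<union> ?O)"
    using sub by (intro gen_fun_Un[symmetric] fin) auto
  also have "?E \<union> ?O = symbols r" using sub by blast
  finally show ?thesis .
qed

lemma gen_fun_symbols: "gen_fun half_hooks (symbols r) = gauss_term 0 r"
proof (induction r)
  case 0
  have "{ps \<in> {[]}. half_hooks ps = n} = (if n = 0 then {[]} else {})" for n
    by (auto simp: half_hooks_def)
  then show ?case unfolding symbols_0 by (intro fps_ext) (simp add: gen_fun_def)
next
  case (Suc r)
  have "(1 - fps_X ^ Suc r) * (1 - fps_X ^ Suc r) * gen_fun half_hooks (symbols (Suc r)) =
      (1 - fps_X ^ Suc r) * (1 - fps_X ^ Suc r) * gauss_term 0 (Suc r)"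
    unfolding gen_fun_symbols_corner gen_fun_corner_symbols Suc
    using gauss_term_Suc[of r 0] by (simp only: add_0)
  then show ?case
    using one_minus_X_power_nonzero[of r] by (metis mult_left_cancel no_zero_divisors)
qed

section \<open>Partitions and their Frobenius symbols\<close>

text \<open>Here the outermost column comes first, opposite to \<open>symbols\<close>. A hook with
  arm a and leg b is wrapped around the inner partition: \<open>Suc\<close> on the inner parts and
  the padding ones form the new first column. The truncated subtraction is harmless once the inner
  partition has at most b rows.\<close>

fun of_frobenius :: "(nat \<times> nat) list \<Rightarrow> nat list" where
  "of_frobenius [] = []"
| "of_frobenius ((a, b) # ps) =
     Suc a # map Suc (of_frobenius ps) @ replicate (b - length (of_frobenius ps)) 1"

definition frobenius :: "(nat \<times> nat) list \<Rightarrow> bool" where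
  "frobenius = sorted_wrt (\<lambda>p q. fst q < fst p \<and> snd q < snd p)"

text \<open>The inner diagram fits into a box with b rows and a columns, which is what makes
  wrapping the hook (a, b) around it legitimate.\<close>

lemma of_frobenius_bounds:
  assumes "frobenius ps" "\<forall>p\<in>set ps. fst p < a \<and> snd p < b"
  shows "length (of_frobenius ps) \<le> b" "\<forall>x\<in>set (of_frobenius ps). x \<le> a"
  using assms
proof (induction ps arbitrary: a b rule: of_frobenius.induct)
  case (2 c d ps)
  {
    case 1
    have "length (of_frobenius ps) \<le> d"
      by (rule 2) (use 1 in \<open>auto simp: frobenius_def\<close>)
    then show ?case using 1 by simp
  next
    case 2
    have "\<forall>x\<in>set (of_frobenius ps). x \<le> c"
      by (rule "2.IH") (use 2 in \<open>auto simp: frobenius_def\<close>)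
    then show ?case using 2 by auto
  }
qed simp_all

lemma of_frobenius_Cons_bounds:
  assumes "frobenius ((a, b) # ps)"
  shows "length (of_frobenius ps) \<le> b" "\<forall>x\<in>set (of_frobenius ps). x \<le> a"
  using of_frobenius_bounds[of ps a b] assms by (auto simp: frobenius_def)

lemma length_of_frobenius: "frobenius ((a, b) # ps) \<Longrightarrow> length (of_frobenius ((a, b) # ps)) = Suc b"
  using of_frobenius_Cons_bounds(1)[of a b ps] by simp

lemma frobenius_bounds:
  "p \<in> set ps \<Longrightarrow> frobenius ps \<Longrightarrow> snd p < length (of_frobenius ps) \<and> fst p < hd (of_frobenius ps)"
proof (induction ps)
  case (Cons q ps)
  obtain a b where q: "q = (a, b)" by force
  have "length (of_frobenius (q # ps)) = Suc b" "hd (of_frobenius (q # ps)) = Suc a"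
    using length_of_frobenius[of a b ps] Cons.prems(2) q by simp_all
  then show ?case using Cons.prems q by (auto simp: frobenius_def)
qed simp

lemma of_frobenius_partition:
  "frobenius ps \<Longrightarrow> of_frobenius ps \<in> partitions (\<Sum>p\<leftarrow>ps. fst p + snd p + 1)"
proof (induction ps rule: of_frobenius.induct)
  case 1
  then show ?case by (simp add: partitions_def)
next
  case (2 a b ps)
  have len: "length (of_frobenius ps) \<le> b" and le: "\<forall>x\<in>set (of_frobenius ps). x \<le> a"
    using of_frobenius_Cons_bounds[OF "2.prems"] by auto
  have IH: "of_frobenius ps \<in> partitions (\<Sum>p\<leftarrow>ps. fst p + snd p + 1)"
    using 2 by (auto simp: frobenius_def)
  have rep: "sorted_wrt (\<ge>) (replicate k (Suc 0))" for k by (induction k) auto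
  have sum: "sum_list (map Suc xs) = sum_list xs + length xs" for xs by (induction xs) auto
  show ?case
    using IH len le
    by (auto simp: partitions_def sorted_wrt_append sorted_wrt_map sum sum_list_replicate
        rep)
qed

text \<open>Positive parts become greater than 1 under \<open>Suc\<close>, so filtering out the ones
  discards exactly the padding.\<close>

lemma add_hook_inj:
  assumes "map Suc xs @ replicate k 1 = map Suc ys @ replicate l 1"
    and "\<forall>x\<in>set xs. 0 < x" "\<forall>y\<in>set ys. 0 < y"
  shows "xs = ys"
proof -
  have *: "filter (\<lambda>x. 1 < x) (map Suc zs @ replicate n 1) = map Suc zs" if "\<forall>z\<in>set zs. 0 < z" for zs n
    using that by (induction zs) auto
  have "map Suc xs = map Suc ys"
    using arg_cong[OF assms(1), of "filter (\<lambda>x. 1 < x)"] assms(2,3) by (simp only: *)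
  then show ?thesis by (rule map_injective) simp
qed

lemma of_frobenius_inj:
  "frobenius ps \<Longrightarrow> frobenius qs \<Longrightarrow> of_frobenius ps = of_frobenius qs \<Longrightarrow> ps = qs"
proof (induction ps arbitrary: qs)
  case Nil
  then show ?case by (cases qs rule: of_frobenius.cases) auto
next
  case (Cons p ps)
  obtain a b where p: "p = (a, b)" by force
  have "qs \<noteq> []" using Cons.prems(3) p by auto
  then obtain c d us where qs: "qs = (c, d) # us" by (cases qs) auto
  note prems = Cons.prems[unfolded p qs]
  have fr: "frobenius ps" "frobenius us" using prems(1,2) by (simp_all add: frobenius_def)
  have pos: "\<forall>x\<in>set (of_frobenius vs). 0 < x" if "frobenius vs" for vs
    using of_frobenius_partition[OF that] by (simp add: partitions_def)
  have eq: "Suc a = Suc c" "map Suc (of_frobenius ps) @ replicate (b - length (of_frobenius ps)) 1 =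
      map Suc (of_frobenius us) @ replicate (d - length (of_frobenius us)) 1"
    using prems(3) by (simp_all only: of_frobenius.simps list.inject)
  have "of_frobenius ps = of_frobenius us"
    using eq(2) pos[OF fr(1)] pos[OF fr(2)] by (rule add_hook_inj)
  then have "ps = us" by (rule Cons.IH[OF fr])
  moreover have "Suc b = Suc d"
    using arg_cong[OF prems(3), of length] by (simp only: length_of_frobenius[OF prems(1)] length_of_frobenius[OF prems(2)])
  ultimately show ?case unfolding p qs using eq(1) by simp
qed

lemma remove_ones:
  assumes "sorted_wrt (\<ge>) xs" "\<forall>x\<in>set xs. 0 < x"
  shows "\<exists>ys k. xs = map Suc ys @ replicate k 1 \<and> sorted_wrt (\<ge>) ys \<and> (\<forall>y\<in>set ys. (0::nat) < y)"
  using assms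
proof (induction xs)
  case Nil
  show ?case by (intro exI[of _ "[]"] exI[of _ 0]) simp
next
  case (Cons x xs)
  have "\<exists>ys k. xs = map Suc ys @ replicate k 1 \<and> sorted_wrt (\<ge>) ys \<and> (\<forall>y\<in>set ys. 0 < y)"
    by (rule Cons.IH) (use Cons.prems in simp_all)
  then obtain ys k where xs: "xs = map Suc ys @ replicate k 1"
    and ys: "sorted_wrt (\<ge>) ys" "\<forall>y\<in>set ys. 0 < y" by blast
  show ?case
  proof (cases "x = 1")
    case True
    \<comment> \<open>After a part equal to 1 no larger part can follow.\<close>
    have "ys = []" using Cons.prems(1) True ys(2) unfolding xs by (cases ys) auto
    then show ?thesis using xs True by (intro exI[of _ "[]"] exI[of _ "Suc k"]) simp
  next
    case False
    then obtain z where z: "x = Suc z" "0 < z" using Cons.prems(2) by (cases x) auto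
    have "\<forall>y\<in>set ys. y \<le> z" using Cons.prems(1) z(1) unfolding xs by auto
    then show ?thesis using ys z xs by (intro exI[of _ "z # ys"] exI[of _ k]) simp
  qed
qed

text \<open>The first row and first column are stripped: the arm is \<open>x - 1\<close>, the leg is
  the number of remaining rows, and the ones of the tail vanish with the column.\<close>

lemma of_frobenius_surj:
  assumes "sorted_wrt (\<ge>) xs" "\<forall>x\<in>set xs. 0 < x"
  shows "\<exists>ps. frobenius ps \<and> of_frobenius ps = xs"
  using assms
proof (induction "length xs" arbitrary: xs rule: less_induct)
  case less
  show ?case
  proof (cases xs)
    case Nil
    then show ?thesis by (intro exI[of _ "[]"]) (simp add: frobenius_def)
  next
    case (Cons x t)
    have x: "0 < x" "\<forall>y\<in>set t. y \<le> x" and t0: "sorted_wrt (\<ge>) t" "\<forall>y\<in>set t. 0 < y"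
      using less.prems unfolding Cons by simp_all
    obtain ys k where t: "t = map Suc ys @ replicate k 1" and ys: "sorted_wrt (\<ge>) ys" "\<forall>y\<in>set ys. 0 < y"
      using remove_ones[OF t0] by blast
    have "length ys < length xs" using t Cons by simp
    then obtain qs where qs: "frobenius qs" "of_frobenius qs = ys" using less.hyps ys by blast
    \<comment> \<open>The inner columns are bounded by the first part and the length of
      \<open>ys\<close>; the first part plus one occurs in \<open>t\<close> and so is at most
      \<open>x\<close>.\<close>
    have "fst q < x - 1 \<and> snd q < length t" if "q \<in> set qs" for q
    proof -
      have q: "snd q < length ys" "fst q < hd ys" using frobenius_bounds[OF that qs(1)] qs(2) by auto
      then have "Suc (hd ys) \<in> set t" unfolding t by (cases ys) auto
      then have "Suc (hd ys) \<le> x" using x(2) by blast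
      then show ?thesis using q by (simp add: t)
    qed
    then have "frobenius ((x - 1, length t) # qs)" using qs(1) by (simp add: frobenius_def)
    moreover have "of_frobenius ((x - 1, length t) # qs) = xs"
      using x(1) unfolding Cons by (simp add: qs(2) t)
    ultimately show ?thesis by blast
  qed
qed

section \<open>Hook lengths under wrapping by a hook\<close>

lemma hook_length_corner:
  assumes "\<forall>y\<in>set ys. 0 < y"
  shows "hook_length (Suc a # ys) (0, 0) = Suc (a + length ys)"
proof -
  have "hook (Suc a # ys) (0, 0) = Pair 0 ` {..<Suc a} \<union> (\<lambda>k. (Suc k, 0)) ` {..<length ys}"
  proof (rule set_eqI)
    fix c :: "nat \<times> nat"
    obtain k l where c: "c = (k, l)" by force
    show "c \<in> hook (Suc a # ys) (0, 0) \<longleftrightarrow> c \<in> Pair 0 ` {..<Suc a} \<union> (\<lambda>k. (Suc k, 0)) ` {..<length ys}"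
      using assms by (cases k) (auto simp: c hook_def young_diagram_def)
  qed
  moreover have "card (Pair (0::nat) ` {..<Suc a} \<union> (\<lambda>k. (Suc k, 0)) ` {..<length ys}) =
      card (Pair (0::nat) ` {..<Suc a}) + card ((\<lambda>k. (Suc k, 0::nat)) ` {..<length ys})"
    by (rule card_Un_disjoint) auto
  ultimately show ?thesis
    unfolding hook_length_def by (simp add: card_image inj_on_def)
qed

text \<open>The padding rows have their only cell in column 0, so off the first row and column the
  diagram is the inner one moved diagonally.\<close>

lemma young_diagram_inner:
  "(Suc i, Suc j) \<in> young_diagram (x # map Suc xs @ replicate k 1) \<longleftrightarrow> (i, j) \<in> young_diagram xs"
  by (auto simp: young_diagram_def nth_append)

lemma hook_length_inner:
  "hook_length (x # map Suc xs @ replicate k 1) (Suc i, Suc j) = hook_length xs (i, j)"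
proof -
  have "hook (x # map Suc xs @ replicate k 1) (Suc i, Suc j) = map_prod Suc Suc ` hook xs (i, j)"
  proof (rule set_eqI)
    fix c :: "nat \<times> nat"
    obtain u v where c: "c = (u, v)" by force
    have image: "c \<in> map_prod Suc Suc ` S \<longleftrightarrow> (\<exists>k l. c = (Suc k, Suc l) \<and> (k, l) \<in> S)" for S
      by auto
    show "c \<in> hook (x # map Suc xs @ replicate k 1) (Suc i, Suc j) \<longleftrightarrow> c \<in> map_prod Suc Suc ` hook xs (i, j)"
      unfolding image by (cases u; cases v) (auto simp: c hook_def young_diagram_inner simp del: One_nat_def)
  qed
  moreover have "inj_on (map_prod Suc Suc) (hook xs (i, j))"
    by (auto simp: inj_on_def)
  ultimately show ?thesis unfolding hook_length_def by (simp add: card_image)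
qed

lemma principal_hooks_even_of_frobenius:
  "frobenius ps \<Longrightarrow> principal_hooks_even (of_frobenius ps) \<longleftrightarrow> (\<forall>p\<in>set ps. odd (fst p + snd p))"
proof (induction ps rule: of_frobenius.induct)
  case 1
  then show ?case by (simp add: principal_hooks_even_def young_diagram_def)
next
  case (2 a b ps)
  let ?xs = "of_frobenius ps"
  let ?ys = "map Suc ?xs @ replicate (b - length ?xs) 1"
  have len: "length ?xs \<le> b" using of_frobenius_Cons_bounds(1)[OF "2.prems"] .
  have all_nat: "(\<forall>i. P i) \<longleftrightarrow> P 0 \<and> (\<forall>i. P (Suc i))" for P :: "nat \<Rightarrow> bool"
    by (metis nat.exhaust)
  have "principal_hooks_even (Suc a # ?ys) \<longleftrightarrow> even (hook_length (Suc a # ?ys) (0, 0)) \<and>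
     (\<forall>i. (Suc i, Suc i) \<in> young_diagram (Suc a # ?ys) \<longrightarrow> even (hook_length (Suc a # ?ys) (Suc i, Suc i)))"
    unfolding principal_hooks_even_def by (subst all_nat) (simp add: young_diagram_def)
  also have "hook_length (Suc a # ?ys) (0, 0) = Suc (a + length ?ys)"
    by (rule hook_length_corner) auto
  also have "length ?ys = b" using len by simp
  also have "(\<forall>i. (Suc i, Suc i) \<in> young_diagram (Suc a # ?ys) \<longrightarrow> even (hook_length (Suc a # ?ys) (Suc i, Suc i))) \<longleftrightarrow>
      principal_hooks_even ?xs"
    unfolding principal_hooks_even_def young_diagram_inner hook_length_inner ..
  also have "\<dots> \<longleftrightarrow> (\<forall>p\<in>set ps. odd (fst p + snd p))"
    using 2 by (simp add: frobenius_def)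
  finally show ?case by simp
qed

section \<open>The bijection and the comparison of coefficients\<close>

lemma sum_hooks_eq:
  "\<forall>p\<in>set ps. odd (fst p + snd p) \<Longrightarrow> (\<Sum>p\<leftarrow>ps. fst p + snd p + 1) = 2 * half_hooks ps"
proof (induction ps)
  case (Cons p ps)
  have "even (fst p + snd p + 1)" using Cons.prems by simp
  then have "2 * ((fst p + snd p + 1) div 2) = fst p + snd p + 1" by (rule dvd_mult_div_cancel)
  with Cons show ?case by (simp add: half_hooks_def)
qed (simp add: half_hooks_def)

text \<open>Every column contributes at least 1. Hence r at most m suffices for weight m, and the
  union below is finite.\<close>

lemma length_le_half_hooks: "ps \<in> symbols r \<Longrightarrow> r \<le> half_hooks ps"
proof -
  have "length ps \<le> half_hooks ps" if "\<forall>p\<in>set ps. odd (fst p + snd p)"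
    using that
  proof (induction ps)
    case (Cons p ps)
    have "1 \<le> (fst p + snd p + 1) div 2" using Cons.prems by (cases "fst p + snd p") auto
    with Cons show ?case by (simp add: half_hooks_def)
  qed (simp add: half_hooks_def)
  then show "ps \<in> symbols r \<Longrightarrow> r \<le> half_hooks ps" by (auto simp: symbols_def)
qed

text \<open>\<open>rev\<close> converts the innermost-first order of \<open>symbols\<close> into the
  outermost-first order of \<open>frobenius\<close>.\<close>

lemma bij_betw_symbols_partitions:
  "bij_betw (of_frobenius \<circ> rev) (\<Union>r\<le>m. {ps \<in> symbols r. half_hooks ps = m})
     {xs \<in> partitions (2 * m). principal_hooks_even xs}"
proof -
  let ?A = "\<Union>r\<le>m. {ps \<in> symbols r. half_hooks ps = m}"
  have A: "ps \<in> ?A \<longleftrightarrow> frobenius (rev ps) \<and> (\<forall>p\<in>set ps. odd (fst p + snd p)) \<and> half_hooks ps = m" for ps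
    using length_le_half_hooks[of ps "length ps"]
    by (auto simp: symbols_def frobenius_def sorted_wrt_rev)
  have half_rev: "half_hooks (rev ps) = half_hooks ps" for ps
    by (simp add: half_hooks_def rev_map[symmetric] sum_list_rev)
  show ?thesis
    unfolding bij_betw_def
  proof
    show "inj_on (of_frobenius \<circ> rev) ?A"
    proof (rule inj_onI)
      fix ps qs assume "ps \<in> ?A" "qs \<in> ?A" "(of_frobenius \<circ> rev) ps = (of_frobenius \<circ> rev) qs"
      then have "rev ps = rev qs" unfolding A by (intro of_frobenius_inj) auto
      then show "ps = qs" by simp
    qed
    show "(of_frobenius \<circ> rev) ` ?A = {xs \<in> partitions (2 * m). principal_hooks_even xs}"
    proof (intro equalityI subsetI)
      fix xs assume "xs \<in> (of_frobenius \<circ> rev) ` ?A"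
      then obtain ps where xs: "xs = of_frobenius (rev ps)" and ps: "ps \<in> ?A" by auto
      have "(\<Sum>p\<leftarrow>rev ps. fst p + snd p + 1) = 2 * m"
        using sum_hooks_eq[of "rev ps"] ps half_rev[of ps] unfolding A by simp
      then show "xs \<in> {xs \<in> partitions (2 * m). principal_hooks_even xs}"
        using ps of_frobenius_partition[of "rev ps"] principal_hooks_even_of_frobenius[of "rev ps"]
        unfolding A xs by simp
    next
      fix xs assume xs: "xs \<in> {xs \<in> partitions (2 * m). principal_hooks_even xs}"
      then obtain ps where ps: "frobenius ps" "of_frobenius ps = xs"
        using of_frobenius_surj[of xs] by (auto simp: partitions_def)
      have odd: "\<forall>p\<in>set ps. odd (fst p + snd p)"
        using principal_hooks_even_of_frobenius[OF ps(1)] ps(2) xs by simp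
      have "2 * half_hooks ps = 2 * m"
        using of_frobenius_partition[OF ps(1)] xs unfolding sum_hooks_eq[OF odd] ps(2) by (simp add: partitions_def)
      then have "rev ps \<in> ?A" unfolding A using ps(1) odd half_rev[of ps] by simp
      then show "xs \<in> (of_frobenius \<circ> rev) ` ?A"
        using ps(2) by (intro image_eqI[of _ _ "rev ps"]) simp_all
    qed
  qed
qed

theorem corollary5p4:
  fixes m :: nat
  shows "card {xs \<in> partitions (2 * m). principal_hooks_even xs} = card (overpartitions m)"
proof -
  let ?A = "\<lambda>r. {ps \<in> symbols r. half_hooks ps = m}"
  have "card {xs \<in> partitions (2 * m). principal_hooks_even xs} = card (\<Union>r\<le>m. ?A r)"
    using bij_betw_same_card[OF bij_betw_symbols_partitions] by simp
  also have "\<dots> = (\<Sum>r\<le>m. card (?A r))"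
  proof (rule card_UN_disjoint)
    show "\<forall>r\<in>{..m}. finite (?A r)"
      using finite_fibres_symbols by (simp add: finite_fibres_def)
    show "\<forall>r\<in>{..m}. \<forall>s\<in>{..m}. r \<noteq> s \<longrightarrow> ?A r \<inter> ?A s = {}"
      by (auto simp: symbols_def)
  qed simp
  finally have "rat_of_nat (card {xs \<in> partitions (2 * m). principal_hooks_even xs}) =
      fps_nth (\<Sum>r\<le>m. gauss_term 0 r) m"
    by (simp add: fps_sum_nth gen_fun_symbols[symmetric] gen_fun_def)
  also have "\<dots> = fps_nth (gen_fun over_weight (overpartitions_above 0)) m"
  proof -
    \<comment> \<open>Truncating at R = m gives agreement modulo q^(m+1), just enough for the
      coefficient of q^m.\<close>
    obtain h where "(\<Sum>r\<le>m. gauss_term 0 r) - gen_fun over_weight (overpartitions_above 0) = fps_X ^ Suc m * h"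
      using gauss_sum_overpartitions[of m] by (rule dvdE)
    then have "fps_nth ((\<Sum>r\<le>m. gauss_term 0 r) - gen_fun over_weight (overpartitions_above 0)) m = 0"
      by (simp only: fps_X_power_mult_nth) simp
    then show ?thesis by simp
  qed
  also have "\<dots> = rat_of_nat (card (overpartitions m))"
    by (simp add: gen_fun_def overpartitions_eq)
  finally show ?thesis by simp
qed

end
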